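(* Let $\{x_j\}_{j=1}^N\subset\Omega$ be collocation points and let $\{x_i\}_{i=1}^M$ be kernel centers. Define $$\nabla_k f(x_j):=[\nabla_x\kappa(x_j,x_1)^\top f(x_j),\ldots,\nabla_x\kappa(x_j,x_M)^\top f(x_j)]^\top\in\mathbb{R}^M,$$ $$\nabla_k g(x_j):=[\nabla_x\kappa(x_j,x_1)^\top g(x_j),\ldots,\nabla_x\kappa(x_j,x_M)^\top g(x_j)]^\top\in\mathbb{R}^{M\times m}$$ (in these formulas $x_j$ is a collocation point and the second arguments $x_1,\dots,x_M$ of $\kappa$ are the kernel centers), and for $p\in\mathbb{R}^M$ $$M_j(p):=\begin{bmatrix}2\left(p^\top\nabla_k f(x_j)+q(x_j)\right)&p^\top\nabla_k g(x_j)\\(\nabla_k g(x_j))^\top p&D\end{bmatrix}.$$ Then the constrained program $$\begin{aligned}\text{minimize}_{p\in\mathbb{R}^M}\quad&\|p\|^2\\ \text{subject to}\quad&\sum_{i=1}^M p_i\,\kappa(0,x_i)=0,\\&\sum_{i=1}^M p_i\,\nabla_x\kappa(0,x_i)=0,\\&\sum_{i=1}^M p_i\,\nabla_x^2\kappa(0,x_i)=P,\\&M_j(p)\succeq 0,\quad j=1,\ldots,N,\end{aligned}$$ is a convex semidefinite program that prevents the trivial solution (that is, $p=0$, equivalently the trivial value function $V\equiv0$, is excluded from the feasible set) while enforcing consistency with linearized optimal control theory (that is, every feasible $p$ yields $V(x)=\sum_{i=1}^M p_i\kappa(x,x_i)$ with $V(0)=0$, $\nabla V(0)=0$ and $\n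abla^2V(0)=P$).
   Context: Consider the control-affine system $\dot x=f(x)+g(x)u$, $x\in\mathbb{R}^n$, $u\in\mathbb{R}^m$, with smooth $f:\mathbb{R}^n\to\mathbb{R}^n$, $g:\mathbb{R}^n\to\mathbb{R}^{n\times m}$, and cost $J(x_0,u)=\int_0^\infty[q(x(t))+\tfrac12u(t)^\top Du(t)]\,dt$ with $q:\mathbb{R}^n\to\mathbb{R}_{\ge0}$ and $D\in\mathbb{R}^{m\times m}$ symmetric positive definite. Standing assumptions: $f,g,q$ are at least $C^2$; $f(0)=0$; $q(0)=0$ and $q(x)>0$ for $x\ne0$; with $A=\frac{\partial f}{\partial x}\big|_{x=0}$, $B=g(0)$, $Q=\nabla^2q(0)$, the pair $(A,B)$ is stabilizable and the pair $(A,Q^{1/2})$ is detectable. $P$ denotes the solution of the algebraic Riccati equation $A^\top P+PA-PBD^{-1}B^\top P+Q=0$, which is positive definite, $P\succ0$. $\Omega\subseteq\mathbb{R}^n$ is a domain containing the origin, and $\kappa:\Omega\times\Omega\to\mathbb{R}$ is a symmetric, positive definite, $C^2$ kernel. $\nabla_x\kappa$ and $\nabla_x^2\kappa$ denote gradient and Hessian with respect to the first argument; the kernel centers lie in $\Omega$. The candidate value function associated with $p$ is $V(x)=\sum_{i=1}^Mp_i\kappa(x,x_i)$. $\succeq0$ means symmetric positive semidefinite. *)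

theory Defs
  imports "HOL-Analysis.Analysis"
begin

section \<open>Calculus\<close>

definition C1_on :: "'a::real_normed_vector set \<Rightarrow> ('a \<Rightarrow> 'b::real_normed_vector) \<Rightarrow> bool" where
  "C1_on S f \<longleftrightarrow> (\<exists>f' :: 'a \<Rightarrow> 'a \<Rightarrow>\<^sub>L 'b.
     (\<forall>x\<in>S. (f has_derivative blinfun_apply (f' x)) (at x)) \<and> continuous_on S f')"

definition C2_on :: "'a::real_normed_vector set \<Rightarrow> ('a \<Rightarrow> 'b::real_normed_vector) \<Rightarrow> bool" where
  "C2_on S f \<longleftrightarrow> (\<exists>f' :: 'a \<Rightarrow> 'a \<Rightarrow>\<^sub>L 'b.
     (\<forall>x\<in>S. (f has_derivative blinfun_apply (f' x)) (at x)) \<and> C1_on S f')"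

definition gradient :: "('a::real_inner \<Rightarrow> real) \<Rightarrow> 'a \<Rightarrow> 'a" where
  "gradient f x = (THE D. GDERIV f x :> D)"

definition hessian :: "(real^'n \<Rightarrow> real) \<Rightarrow> real^'n \<Rightarrow> real^'n^'n" where
  "hessian f x = jacobian (gradient f) (at x)"


section \<open>Matrices and linear control theory\<close>

definition symmetric_matrix :: "real^'n^'n \<Rightarrow> bool" where
  "symmetric_matrix S \<longleftrightarrow> transpose S = S"

definition psd :: "real^'n^'n \<Rightarrow> bool" where
  "psd S \<longleftrightarrow> symmetric_matrix S \<and> (\<forall>v. 0 \<le> v \<bullet> (S *v v))"

definition posdef :: "real^'n^'n \<Rightarrow> bool" where
  "posdef S \<longleftrightarrow> symmetric_matrix S \<and> (\<forall>v. v \<noteq> 0 \<longrightarrow> 0 < v \<bullet> (S *v v))"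

text \<open>The square root is meaningful only for positive semidefinite \<open>S\<close>.\<close>

definition psd_sqrt :: "real^'n^'n \<Rightarrow> real^'n^'n" where
  "psd_sqrt S = (THE R. psd R \<and> R ** R = S)"

definition hurwitz :: "real^'n^'n \<Rightarrow> bool" where
  "hurwitz A \<longleftrightarrow> (\<forall>(z::complex) (v::complex^'n).
     v \<noteq> 0 \<and> map_matrix complex_of_real A *v v = z *s v \<longrightarrow> Re z < 0)"

definition stabilizable :: "real^'n^'n \<Rightarrow> real^'m^'n \<Rightarrow> bool" where
  "stabilizable A B \<longleftrightarrow> (\<exists>K :: real^'n^'m. hurwitz (A + B ** K))"

definition detectable :: "real^'n^'n \<Rightarrow> real^'n^'k \<Rightarrow> bool" where
  "detectable A C \<longleftrightarrow> (\<exists>L :: real^'k^'n. hurwitz (A + L ** C))"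

definition riccati_solution ::
  "real^'n^'n \<Rightarrow> real^'m^'n \<Rightarrow> real^'m^'m \<Rightarrow> real^'n^'n \<Rightarrow> real^'n^'n \<Rightarrow> bool" where
  "riccati_solution A B D Q P \<longleftrightarrow>
     transpose A ** P + P ** A - P ** B ** matrix_inv D ** transpose B ** P + Q = 0"


section \<open>Kernels\<close>

definition symmetric_kernel :: "'a set \<Rightarrow> ('a \<Rightarrow> 'a \<Rightarrow> real) \<Rightarrow> bool" where
  "symmetric_kernel \<Omega> \<kappa> \<longleftrightarrow> (\<forall>x\<in>\<Omega>. \<forall>y\<in>\<Omega>. \<kappa> x y = \<kappa> y x)"

text \<open>Positive definiteness in the sense of reproducing kernel Hilbert spaces (all Gram matrices
  are positive semidefinite), and the strict version, in which Gram matrices of pairwise distinct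
  points are nonsingular.\<close>

definition positive_definite_kernel :: "'a set \<Rightarrow> ('a \<Rightarrow> 'a \<Rightarrow> real) \<Rightarrow> bool" where
  "positive_definite_kernel \<Omega> \<kappa> \<longleftrightarrow>
     (\<forall>S a. finite S \<and> S \<subseteq> \<Omega> \<longrightarrow> 0 \<le> (\<Sum>x\<in>S. \<Sum>y\<in>S. a x * a y * \<kappa> x y))"

definition strictly_positive_definite_kernel :: "'a set \<Rightarrow> ('a \<Rightarrow> 'a \<Rightarrow> real) \<Rightarrow> bool" where
  "strictly_positive_definite_kernel \<Omega> \<kappa> \<longleftrightarrow>
     (\<forall>S a. finite S \<and> S \<subseteq> \<Omega> \<and> (\<exists>x\<in>S. a x \<noteq> 0) \<longrightarrow>
        0 < (\<Sum>x\<in>S. \<Sum>y\<in>S. a x * a y * \<kappa> x y))"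

definition value_function ::
  "(real^'n \<Rightarrow> real^'n \<Rightarrow> real) \<Rightarrow> ('M::finite \<Rightarrow> real^'n) \<Rightarrow> real^'M \<Rightarrow> real^'n \<Rightarrow> real" where
  "value_function \<kappa> c p x = (\<Sum>i\<in>UNIV. p $ i * \<kappa> x (c i))"


section \<open>Convex semidefinite programs\<close>

text \<open>Minimize \<open>objective p\<close> over \<open>p\<close> subject to \<open>eq_lhs p = eq_rhs\<close> and \<open>lmi j p \<succeq> 0\<close>
  for all \<open>j\<close>. Finitely many equations are collected in one equation in a product space.\<close>

record ('M, 'e, 'j, 'k) matrix_program =
  objective :: "real^'M \<Rightarrow> real"
  eq_lhs :: "real^'M \<Rightarrow> 'e"
  eq_rhs :: "'e"
  lmi :: "'j \<Rightarrow> real^'M \<Rightarrow> real^'k^'k"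

definition feasible_set :: "('M::finite, 'e, 'j, 'k::finite) matrix_program \<Rightarrow> (real^'M) set" where
  "feasible_set prg = {p. eq_lhs prg p = eq_rhs prg \<and> (\<forall>j. psd (lmi prg j p))}"

definition affine_symmetric_matrix_map :: "('v::real_vector \<Rightarrow> real^'k^'k) \<Rightarrow> bool" where
  "affine_symmetric_matrix_map F \<longleftrightarrow> (\<exists>F0 L. symmetric_matrix F0 \<and> linear L \<and>
     (\<forall>v. symmetric_matrix (L v)) \<and> (\<forall>v. F v = F0 + L v))"

text \<open>The last clause says that minimizing the (possibly nonlinear) objective is a semidefinite
  program in the narrow sense: minimize \<open>t\<close> subject to the given constraints and one more linear
  matrix inequality in \<open>(p, t)\<close> describing the epigraph. By a Schur complement, size
  \<open>1 + dim p\<close> suffices for every linear or convex quadratic objective.\<close>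

definition convex_semidefinite_program ::
  "('M::finite, 'e::real_vector, 'j::finite, 'k::finite) matrix_program \<Rightarrow> bool" where
  "convex_semidefinite_program prg \<longleftrightarrow>
     convex_on UNIV (objective prg) \<and>
     convex (feasible_set prg) \<and>
     linear (eq_lhs prg) \<and>
     (\<forall>j. affine_symmetric_matrix_map (lmi prg j)) \<and>
     (\<exists>G :: (real^'M) \<times> real \<Rightarrow> real^(unit + 'M)^(unit + 'M).
        affine_symmetric_matrix_map G \<and>
        (\<forall>p t. objective prg p \<le> t \<longleftrightarrow> psd (G (p, t))))"


section \<open>The program for the value function\<close>

definition kernel_drift ::
  "(real^'n \<Rightarrow> real^'n \<Rightarrow> real) \<Rightarrow> ('M::finite \<Rightarrow> real^'n) \<Rightarrow> (real^'n \<Rightarrow> real^'n) \<Rightarrow>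
   real^'n \<Rightarrow> real^'M" where
  "kernel_drift \<kappa> c f y = (\<chi> i. gradient (\<lambda>x. \<kappa> x (c i)) y \<bullet> f y)"

definition kernel_input ::
  "(real^'n \<Rightarrow> real^'n \<Rightarrow> real) \<Rightarrow> ('M::finite \<Rightarrow> real^'n) \<Rightarrow> (real^'n \<Rightarrow> real^'m^'n) \<Rightarrow>
   real^'n \<Rightarrow> real^'m^'M" where
  "kernel_input \<kappa> c g y = (\<chi> i. gradient (\<lambda>x. \<kappa> x (c i)) y v* g y)"

text \<open>The block matrix with scalar \<open>a\<close>, row \<open>b\<close>, column \<open>c\<close> and square block \<open>D\<close>.\<close>

definition block_matrix ::
  "real \<Rightarrow> real^'m \<Rightarrow> real^'m \<Rightarrow> real^'m^'m \<Rightarrow> real^(unit + 'm)^(unit + 'm)" where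
  "block_matrix a b c D = (\<chi> r s. case r of
      Inl _ \<Rightarrow> (case s of Inl _ \<Rightarrow> a | Inr l \<Rightarrow> b $ l)
    | Inr k \<Rightarrow> (case s of Inl _ \<Rightarrow> c $ k | Inr l \<Rightarrow> D $ k $ l))"

definition hjb_matrix ::
  "(real^'n \<Rightarrow> real^'n \<Rightarrow> real) \<Rightarrow> ('M::finite \<Rightarrow> real^'n) \<Rightarrow> (real^'n \<Rightarrow> real^'n) \<Rightarrow>
   (real^'n \<Rightarrow> real^'m^'n) \<Rightarrow> (real^'n \<Rightarrow> real) \<Rightarrow> real^'m^'m \<Rightarrow> real^'n \<Rightarrow> real^'M \<Rightarrow>
   real^(unit + 'm)^(unit + 'm)" where
  "hjb_matrix \<kappa> c f g q D y p = block_matrix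
     (2 * (p \<bullet> kernel_drift \<kappa> c f y + q y)) (p v* kernel_input \<kappa> c g y)
     (transpose (kernel_input \<kappa> c g y) *v p) D"

definition hjb_program ::
  "(real^'n \<Rightarrow> real^'n \<Rightarrow> real) \<Rightarrow> ('M::finite \<Rightarrow> real^'n) \<Rightarrow> ('N::finite \<Rightarrow> real^'n) \<Rightarrow>
   (real^'n \<Rightarrow> real^'n) \<Rightarrow> (real^'n \<Rightarrow> real^'m^'n) \<Rightarrow> (real^'n \<Rightarrow> real) \<Rightarrow>
   real^'m^'m \<Rightarrow> real^'n^'n \<Rightarrow>
   ('M, real \<times> (real^'n) \<times> (real^'n^'n), 'N, unit + 'm) matrix_program" where
  "hjb_program \<kappa> c y f g q D P = \<lparr>
     objective = (\<lambda>p. (norm p)\<^sup>2),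
     eq_lhs = (\<lambda>p. (\<Sum>i\<in>UNIV. p $ i * \<kappa> 0 (c i),
                    \<Sum>i\<in>UNIV. p $ i *\<^sub>R gradient (\<lambda>x. \<kappa> x (c i)) 0,
                    \<Sum>i\<in>UNIV. p $ i *\<^sub>R hessian (\<lambda>x. \<kappa> x (c i)) 0)),
     eq_rhs = (0, 0, P),
     lmi = (\<lambda>j p. hjb_matrix \<kappa> c f g q D (y j) p) \<rparr>"

end

theory Submission
  imports Defs
begin

text \<open>Gradient and Hessian at \<open>0\<close> are linear on \<open>C\<^sup>2\<close> functions, so the three equality constraints
  say precisely that the value function has the 2-jet \<open>(0, 0, P)\<close> at the origin; as \<open>P \<noteq> 0\<close>, this
  excludes \<open>p = 0\<close> and any value function that vanishes near the origin. Each matrix \<open>M\<^sub>j\<close> is affine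
  in \<open>p\<close>, and completing the square shows that \<open>\<parallel>p\<parallel>\<^sup>2 \<le> t\<close> iff the block matrix with scalar \<open>t\<close>,
  off-diagonal \<open>p\<close> and identity block is positive semidefinite.\<close>

section \<open>Calculus\<close>

lemma C1_onI:
  assumes "\<And>x. x \<in> S \<Longrightarrow> (f has_derivative blinfun_apply (f' x)) (at x)" "continuous_on S f'"
  shows "C1_on S f"
  using assms unfolding C1_on_def by blast

lemma C2_onI:
  assumes "\<And>x. x \<in> S \<Longrightarrow> (f has_derivative blinfun_apply (f' x)) (at x)" "C1_on S f'"
  shows "C2_on S f"
  using assms unfolding C2_on_def by blast

text \<open>Derivatives here are operator-valued maps, and the operations applied to them below,
  scaling and composing with a fixed operator, are bounded linear; this rule keeps them
  \<open>C1_on\<close>.\<close>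

lemma C1_on_linear_comp:
  assumes B: "bounded_linear B" and f: "C1_on S f"
  shows "C1_on S (\<lambda>x. B (f x))"
proof -
  obtain f' where f': "\<And>x. x \<in> S \<Longrightarrow> (f has_derivative blinfun_apply (f' x)) (at x)"
    and cont: "continuous_on S f'"
    using f unfolding C1_on_def by blast
  have "((\<lambda>x. B (f x)) has_derivative blinfun_apply (Blinfun B o\<^sub>L f' x)) (at x)" if "x \<in> S" for x
  proof -
    have "blinfun_apply (Blinfun B o\<^sub>L f' x) = (\<lambda>h. B (blinfun_apply (f' x) h))"
      using B by (auto simp: bounded_linear_Blinfun_apply)
    then show ?thesis
      using bounded_linear.has_derivative[OF B f'[OF that]] by simp
  qed
  moreover have "continuous_on S (\<lambda>x. Blinfun B o\<^sub>L f' x)"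
    by (intro continuous_intros cont)
  ultimately show ?thesis
    by (rule C1_onI)
qed

lemma has_derivative_affine_arg:
  assumes L: "bounded_linear L" and f: "(f has_derivative blinfun_apply f') (at (a + L x))"
  shows "((\<lambda>x. f (a + L x)) has_derivative blinfun_apply (f' o\<^sub>L Blinfun L)) (at x)"
proof -
  have "((\<lambda>x. a + L x) has_derivative L) (at x)"
    using bounded_linear_imp_has_derivative[OF L] by (auto intro!: derivative_eq_intros)
  from has_derivative_compose[OF this f] show ?thesis
    using L by (simp add: bounded_linear_Blinfun_apply o_def blinfun_compose.rep_eq)
qed

lemma C1_on_affine_arg:
  assumes L: "bounded_linear L" and f: "C1_on S f" and sub: "\<And>x. x \<in> T \<Longrightarrow> a + L x \<in> S"
  shows "C1_on T (\<lambda>x. f (a + L x))"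
proof -
  obtain f' where f': "\<And>x. x \<in> S \<Longrightarrow> (f has_derivative blinfun_apply (f' x)) (at x)"
    and cont: "continuous_on S f'"
    using f unfolding C1_on_def by blast
  have Lc: "continuous_on T (\<lambda>x. a + L x)"
    by (intro continuous_intros bounded_linear.continuous_on[OF L])
  have "((\<lambda>x. f (a + L x)) has_derivative blinfun_apply (f' (a + L x) o\<^sub>L Blinfun L)) (at x)"
    if "x \<in> T" for x
    by (rule has_derivative_affine_arg[OF L f'[OF sub[OF that]]])
  moreover have "continuous_on T (\<lambda>x. f' (a + L x) o\<^sub>L Blinfun L)"
    using continuous_on_compose2[OF cont Lc] sub by (intro continuous_intros) auto
  ultimately show ?thesis
    by (rule C1_onI)
qed

text \<open>By the chain rule the derivative at x is \<open>f' (a + L x)\<close> followed by the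
  fixed linear operation T -> T o L. So first-order regularity under affine substitution, plus a
  linear post-composition, yields the second order. The intended substitution embeds \<Omega> as a
  slice of \<Omega> \<times> \<Omega>.\<close>

lemma C2_on_affine_arg:
  assumes L: "bounded_linear L" and f: "C2_on S f" and sub: "\<And>x. x \<in> T \<Longrightarrow> a + L x \<in> S"
  shows "C2_on T (\<lambda>x. f (a + L x))"
proof -
  obtain f' where f': "\<And>x. x \<in> S \<Longrightarrow> (f has_derivative blinfun_apply (f' x)) (at x)"
    and C1: "C1_on S f'"
    using f unfolding C2_on_def by blast
  have "((\<lambda>x. f (a + L x)) has_derivative blinfun_apply (f' (a + L x) o\<^sub>L Blinfun L)) (at x)"
    if "x \<in> T" for x
    by (rule has_derivative_affine_arg[OF L f'[OF sub[OF that]]])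
  moreover have "C1_on T (\<lambda>x. f' (a + L x) o\<^sub>L Blinfun L)"
    by (rule C1_on_linear_comp[OF bounded_bilinear.bounded_linear_left[OF bounded_bilinear_blinfun_compose]
          C1_on_affine_arg[OF L C1 sub]])
  ultimately show ?thesis
    by (rule C2_onI)
qed

lemma C1_on_sum:
  assumes "\<And>i. i \<in> I \<Longrightarrow> C1_on S (f i)"
  shows "C1_on S (\<lambda>x. \<Sum>i\<in>I. f i x)"
proof -
  obtain f' where f': "\<And>i x. i \<in> I \<Longrightarrow> x \<in> S \<Longrightarrow> (f i has_derivative blinfun_apply (f' i x)) (at x)"
    and cont: "\<And>i. i \<in> I \<Longrightarrow> continuous_on S (f' i)"
    using assms unfolding C1_on_def by metis
  have "((\<lambda>x. \<Sum>i\<in>I. f i x) has_derivative blinfun_apply (\<Sum>i\<in>I. f' i x)) (at x)" if "x \<in> S" for x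
    using has_derivative_sum[of I f "\<lambda>i. blinfun_apply (f' i x)" "at x"] f' that
    by (simp add: blinfun.sum_left[abs_def])
  moreover have "continuous_on S (\<lambda>x. \<Sum>i\<in>I. f' i x)"
    by (intro continuous_intros cont)
  ultimately show ?thesis
    by (rule C1_onI)
qed

lemma C2_on_linear_combination:
  fixes a :: "'i \<Rightarrow> real"
  assumes "\<And>i. i \<in> I \<Longrightarrow> C2_on S (f i)"
  shows "C2_on S (\<lambda>x. \<Sum>i\<in>I. a i *\<^sub>R f i x)"
proof -
  obtain f' where f': "\<And>i x. i \<in> I \<Longrightarrow> x \<in> S \<Longrightarrow> (f i has_derivative blinfun_apply (f' i x)) (at x)"
    and C1: "\<And>i. i \<in> I \<Longrightarrow> C1_on S (f' i)"
    using assms unfolding C2_on_def by metis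
  have "((\<lambda>x. \<Sum>i\<in>I. a i *\<^sub>R f i x) has_derivative blinfun_apply (\<Sum>i\<in>I. a i *\<^sub>R f' i x)) (at x)"
    if "x \<in> S" for x
  proof -
    have "((\<lambda>x. \<Sum>i\<in>I. a i *\<^sub>R f i x) has_derivative
        (\<lambda>h. \<Sum>i\<in>I. a i *\<^sub>R blinfun_apply (f' i x) h)) (at x)"
      using f' that by (intro has_derivative_sum has_derivative_scaleR_right)
    then show ?thesis
      by (simp add: blinfun.sum_left[abs_def] blinfun.scaleR_left)
  qed
  moreover have "C1_on S (\<lambda>x. \<Sum>i\<in>I. a i *\<^sub>R f' i x)"
    by (intro C1_on_sum C1_on_linear_comp[OF bounded_linear_scaleR_right] C1)
  ultimately show ?thesis
    by (rule C2_onI)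
qed

section \<open>Gradients and Hessians as linear operations\<close>

lemma gradient_eqI:
  assumes "GDERIV f x :> D"
  shows "gradient f x = D"
proof -
  have "E = D" if "GDERIV f x :> E" for E
  proof -
    \<comment> \<open>\<open>gradient\<close> is a definite description, so uniqueness is required:
      the derivative is unique, and the inner product separates vectors.\<close>
    have "(\<lambda>h. h \<bullet> E) = (\<lambda>h. h \<bullet> D)"
      using has_derivative_unique assms that unfolding gderiv_def by blast
    then show "E = D"
      by (metis inner_commute vector_eq_ldot)
  qed
  then show ?thesis
    unfolding gradient_def using assms by blast
qed

text \<open>Riesz representation in finite dimension: the coordinates of the representing vector are
  the values of the functional on an orthonormal basis. This turns \<open>C2_on\<close> data into an
  explicit gradient, linear in the derivative.\<close>

lemma gderiv_of_derivative:
  fixes f :: "'a::euclidean_space \<Rightarrow> real"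
  assumes "(f has_derivative f') (at x)"
  shows "GDERIV f x :> (\<Sum>b\<in>Basis. f' b *\<^sub>R b)"
proof -
  have "f' = (\<lambda>h. h \<bullet> (\<Sum>b\<in>Basis. f' b *\<^sub>R b))"
  proof
    fix h
    interpret f': linear f'
      using assms by (rule has_derivative_linear)
    have "f' h = f' (\<Sum>b\<in>Basis. (h \<bullet> b) *\<^sub>R b)"
      by (simp add: euclidean_representation)
    also have "\<dots> = (\<Sum>b\<in>Basis. (h \<bullet> b) * f' b)"
      by (simp add: f'.sum f'.scaleR)
    finally show "f' h = h \<bullet> (\<Sum>b\<in>Basis. f' b *\<^sub>R b)"
      by (simp add: inner_sum_right mult.commute)
  qed
  then show ?thesis
    unfolding gderiv_def using assms by simp
qed

lemma C2_on_gderiv_gradient: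
  fixes f :: "'a::euclidean_space \<Rightarrow> real"
  assumes "C2_on S f" "x \<in> S"
  shows "GDERIV f x :> gradient f x"
  using assms gderiv_of_derivative gradient_eqI unfolding C2_on_def by metis

lemma C2_on_gradient_differentiable:
  fixes f :: "'a::euclidean_space \<Rightarrow> real"
  assumes "C2_on S f" "open S" "x \<in> S"
  shows "gradient f differentiable (at x)"
proof -
  obtain f' where f': "\<And>x. x \<in> S \<Longrightarrow> (f has_derivative blinfun_apply (f' x)) (at x)"
    and C1: "C1_on S f'"
    using assms unfolding C2_on_def by blast
  obtain f'' where f'': "(f' has_derivative f'') (at x)"
    using C1 \<open>x \<in> S\<close> unfolding C1_on_def by blast
  have "((\<lambda>y. \<Sum>b\<in>Basis. blinfun_apply (f' y) b *\<^sub>R b) has_derivative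
      (\<lambda>h. \<Sum>b\<in>Basis. blinfun_apply (f'' h) b *\<^sub>R b)) (at x)"
    by (intro has_derivative_sum has_derivative_scaleR_left
        bounded_linear.has_derivative[OF blinfun.bounded_linear_left f''])
  \<comment> \<open>The expansion agrees with \<open>gradient f\<close> throughout the open set S,
    hence near x, so the derivative carries over.\<close>
  then have "(gradient f has_derivative
      (\<lambda>h. \<Sum>b\<in>Basis. blinfun_apply (f'' h) b *\<^sub>R b)) (at x)"
    by (rule has_derivative_transform_within_open[OF _ \<open>open S\<close> \<open>x \<in> S\<close>])
      (simp add: gradient_eqI[OF gderiv_of_derivative[OF f']])
  then show ?thesis
    unfolding differentiable_def by blast
qed

lemma gradient_linear_combination:
  fixes f :: "'i \<Rightarrow> 'a::euclidean_space \<Rightarrow> real"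
  assumes "\<And>i. i \<in> I \<Longrightarrow> C2_on S (f i)" "x \<in> S"
  shows "gradient (\<lambda>x. \<Sum>i\<in>I. a i * f i x) x = (\<Sum>i\<in>I. a i *\<^sub>R gradient (f i) x)"
proof (rule gradient_eqI)
  have "((\<lambda>x. \<Sum>i\<in>I. a i * f i x) has_derivative (\<lambda>h. \<Sum>i\<in>I. a i * (h \<bullet> gradient (f i) x))) (at x)"
    using C2_on_gderiv_gradient[OF assms] unfolding gderiv_def
    by (intro has_derivative_sum has_derivative_mult_right)
  then show "GDERIV (\<lambda>x. \<Sum>i\<in>I. a i * f i x) x :> (\<Sum>i\<in>I. a i *\<^sub>R gradient (f i) x)"
    unfolding gderiv_def by (simp add: inner_sum_right)
qed

text \<open>The gradient formula holds on all of the open set S, not only at x, so it can be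
  differentiated once more.\<close>

lemma hessian_linear_combination:
  fixes f :: "'i \<Rightarrow> real^'n \<Rightarrow> real"
  assumes f: "\<And>i. i \<in> I \<Longrightarrow> C2_on S (f i)" and S: "open S" "x \<in> S"
  shows "hessian (\<lambda>x. \<Sum>i\<in>I. a i * f i x) x = (\<Sum>i\<in>I. a i *\<^sub>R hessian (f i) x)"
proof -
  define H where "H i = frechet_derivative (gradient (f i)) (at x)" for i
  have "((\<lambda>x. \<Sum>i\<in>I. a i *\<^sub>R gradient (f i) x) has_derivative (\<lambda>h. \<Sum>i\<in>I. a i *\<^sub>R H i h)) (at x)"
    unfolding H_def
    by (intro has_derivative_sum has_derivative_scaleR_right
        frechet_derivative_works[THEN iffD1] C2_on_gradient_differentiable[OF f S])
  then have "(gradient (\<lambda>x. \<Sum>i\<in>I. a i * f i x) has_derivative (\<lambda>h. \<Sum>i\<in>I. a i *\<^sub>R H i h)) (at x)"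
    by (rule has_derivative_transform_within_open[OF _ S])
      (simp add: gradient_linear_combination[OF f])
  then have "frechet_derivative (gradient (\<lambda>x. \<Sum>i\<in>I. a i * f i x)) (at x) = (\<lambda>h. \<Sum>i\<in>I. a i *\<^sub>R H i h)"
    by (rule frechet_derivative_at[symmetric])
  then show ?thesis
    unfolding hessian_def jacobian_def
    by (simp add: vec_eq_iff matrix_def H_def)
qed

text \<open>A value function vanishing on \<Omega> has zero Hessian at the origin, which clashes
  with the constraint that this Hessian be the nonzero matrix P.\<close>

lemma hessian_eq_0:
  fixes f :: "real^'a \<Rightarrow> real"
  assumes S: "open S" "x \<in> S" and zero: "\<And>z. z \<in> S \<Longrightarrow> f z = 0"
  shows "hessian f x = 0"
proof -
  have "gradient f z = 0" if "z \<in> S" for z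
  proof -
    have "(f has_derivative (\<lambda>h. 0)) (at z)"
      by (rule has_derivative_transform_within_open[OF has_derivative_const \<open>open S\<close> that])
        (simp add: zero)
    then show ?thesis
      by (intro gradient_eqI) (simp add: gderiv_def)
  qed
  then have "(gradient f has_derivative (\<lambda>h. 0)) (at x)"
    by (intro has_derivative_transform_within_open[OF has_derivative_const S]) simp
  then have "frechet_derivative (gradient f) (at x) = (\<lambda>h. 0)"
    by (rule frechet_derivative_at[symmetric])
  then have "hessian f x = matrix (\<lambda>h :: real^'a. 0 :: real^'a)"
    by (simp only: hessian_def jacobian_def)
  also have "\<dots> = 0"
    by (simp add: matrix_def vec_eq_iff)
  finally show ?thesis .
qed


section \<open>Convexity and positive semidefinite matrices\<close>

lemma symmetric_matrix_add: "symmetric_matrix S \<Longrightarrow> symmetric_matrix T \<Longrightarrow> symmetric_matrix (S + T)"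
  unfolding symmetric_matrix_def by (simp add: transpose_def vec_eq_iff)

lemma symmetric_matrix_scaleR: "symmetric_matrix S \<Longrightarrow> symmetric_matrix (r *\<^sub>R S)"
  unfolding symmetric_matrix_def by (simp add: transpose_def vec_eq_iff)

lemma symmetric_matrix_mat: "symmetric_matrix (mat r)"
  unfolding symmetric_matrix_def by (simp add: transpose_mat)

text \<open>Symmetry and, for each fixed v, the value of the quadratic form at v are linear in the
  matrix, so nonnegative combinations preserve both conditions.\<close>

lemma convex_psd: "convex {S. psd S}"
proof (rule convexI)
  fix S T :: "real^'n^'n" and u v :: real
  assume "S \<in> {S. psd S}" "T \<in> {S. psd S}" "0 \<le> u" "0 \<le> v"
  then show "u *\<^sub>R S + v *\<^sub>R T \<in> {S. psd S}"
    by (simp add: psd_def symmetric_matrix_add symmetric_matrix_scaleR matrix_vector_mult_add_rdistrib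
        inner_add_right scaleR_matrix_vector_assoc[symmetric])
qed

lemma convex_psd_preimage:
  assumes "affine_symmetric_matrix_map F"
  shows "convex {v. psd (F v)}"
proof -
  obtain F0 L where L: "linear L" and F: "\<And>v. F v = F0 + L v"
    using assms unfolding affine_symmetric_matrix_map_def by blast
  \<comment> \<open>The affine preimage is split into a translation of the cone by
    \<open>- F0\<close> and a linear preimage, each preserving convexity.\<close>
  have "convex (L -` ((\<lambda>S. - F0 + S) ` {S. psd S}))"
    by (intro convex_linear_vimage[OF L] convex_translation convex_psd)
  moreover have "L -` ((\<lambda>S. - F0 + S) ` {S. psd S}) = {v. psd (F v)}"
    by (force simp: F image_iff intro: exI[of _ "F0 + L _"])
  ultimately show ?thesis
    by simp
qed

section \<open>Quadratic forms of bordered block matrices\<close>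

lemma sum_UNIV_unit_plus:
  fixes h :: "unit + 'm::finite \<Rightarrow> 'b::comm_monoid_add"
  shows "sum h UNIV = h (Inl ()) + (\<Sum>k\<in>UNIV. h (Inr k))"
  by (simp add: UNIV_Plus_UNIV[symmetric] sum.Plus UNIV_unit del: UNIV_Plus_UNIV)

lemma inner_block_matrix:
  "v \<bullet> (block_matrix a b b D *v v) =
    a * (v $ Inl ())\<^sup>2 + 2 * v $ Inl () * (b \<bullet> (\<chi> k. v $ Inr k)) +
    (\<chi> k. v $ Inr k) \<bullet> (D *v (\<chi> k. v $ Inr k))"
  by (simp add: inner_vec_def matrix_vector_mult_def block_matrix_def sum_UNIV_unit_plus
      algebra_simps sum.distrib sum_distrib_left power2_eq_square)

lemma symmetric_block_matrix:
  assumes "symmetric_matrix D"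
  shows "symmetric_matrix (block_matrix a b b D)"
  using assms unfolding symmetric_matrix_def
  by (simp add: transpose_def vec_eq_iff block_matrix_def split: sum.splits)

lemma affine_block_matrix:
  fixes a :: "'v::real_vector \<Rightarrow> real" and b :: "'v \<Rightarrow> real^'m"
  assumes "linear a" "linear b" "symmetric_matrix D"
  shows "affine_symmetric_matrix_map (\<lambda>v. block_matrix (a0 + a v) (b v) (b v) D)"
  unfolding affine_symmetric_matrix_map_def
proof (intro exI conjI allI)
  \<comment> \<open>The fixed block D belongs to the constant term; the linear part has a zero block
    in its place.\<close>
  show "symmetric_matrix (block_matrix a0 0 0 D)"
    using assms by (simp add: symmetric_block_matrix)
  show "linear (\<lambda>v. block_matrix (a v) (b v) (b v) 0)"
    using assms
    by (intro linearI) (auto simp: linear_add linear_scale vec_eq_iff block_matrix_def split: sum.splits)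
  show "symmetric_matrix (block_matrix (a v) (b v) (b v) 0)" for v
    by (intro symmetric_block_matrix) (simp add: symmetric_matrix_def transpose_def vec_eq_iff)
  show "block_matrix (a0 + a v) (b v) (b v) D = block_matrix a0 0 0 D + block_matrix (a v) (b v) (b v) 0" for v
    by (auto simp: vec_eq_iff block_matrix_def split: sum.splits)
qed

lemma psd_block_matrix_identity:
  fixes p :: "real^'m"
  shows "psd (block_matrix t p p (mat 1)) \<longleftrightarrow> (norm p)\<^sup>2 \<le> t"
proof
  assume psd: "psd (block_matrix t p p (mat 1))"
  \<comment> \<open>With first component 1 and remainder w the form is
    \<open>t + 2 * (p \<bullet> w) + w \<bullet> w\<close>, which is least at w = -p.\<close>
  define v :: "real^(unit + 'm)" where "v = (\<chi> r. case r of Inl _ \<Rightarrow> 1 | Inr k \<Rightarrow> - p $ k)"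
  have "v $ Inl () = 1" "(\<chi> k. v $ Inr k) = - p"
    by (simp_all add: v_def vec_eq_iff)
  then have "v \<bullet> (block_matrix t p p (mat 1) *v v) = t - (norm p)\<^sup>2"
    by (simp only: inner_block_matrix) (simp add: power2_norm_eq_inner)
  then show "(norm p)\<^sup>2 \<le> t"
    using psd unfolding psd_def by (metis diff_ge_0_iff_ge)
next
  assume t: "(norm p)\<^sup>2 \<le> t"
  have "0 \<le> v \<bullet> (block_matrix t p p (mat 1) *v v)" for v
  proof -
    define s w where "s = v $ Inl ()" and "w = (\<chi> k. v $ Inr k)"
    \<comment> \<open>This perfect square is the quadratic form with t lowered to the squared norm
      of p.\<close>
    have "0 \<le> (norm (s *\<^sub>R p + w))\<^sup>2"
      by simp
    also have "\<dots> = (norm p)\<^sup>2 * s\<^sup>2 + 2 * s * (p \<bullet> w) + w \<bullet> w"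
      unfolding power2_norm_eq_inner
      by (simp add: inner_add_left inner_add_right inner_commute power2_eq_square algebra_simps)
    also have "\<dots> \<le> t * s\<^sup>2 + 2 * s * (p \<bullet> w) + w \<bullet> w"
      using t by (simp add: mult_right_mono)
    finally show ?thesis
      by (simp add: inner_block_matrix s_def w_def)
  qed
  then show "psd (block_matrix t p p (mat 1))"
    unfolding psd_def by (simp add: symmetric_block_matrix symmetric_matrix_mat)
qed

text \<open>The index type is nonempty, so the all-ones vector is nonzero and tests
  positivity.\<close>

lemma posdef_nonzero: "posdef (S :: real^'n^'n) \<Longrightarrow> S \<noteq> 0"
  unfolding posdef_def by (metis inner_zero_right less_irrefl matrix_vector_mult_0 zero_neq_one)


lemma convex_on_norm_squared: "convex_on UNIV (\<lambda>p :: 'a::real_inner. (norm p)\<^sup>2)"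
proof (rule convex_onI)
  fix t :: real and p r :: 'a
  assume t: "0 < t" "t < 1"
  \<comment> \<open>The convexity defect is computed exactly and is a nonnegative multiple of the
    squared distance.\<close>
  have "(1 - t) * (norm p)\<^sup>2 + t * (norm r)\<^sup>2 - (norm ((1 - t) *\<^sub>R p + t *\<^sub>R r))\<^sup>2 =
      t * (1 - t) * (norm (p - r))\<^sup>2"
    unfolding power2_norm_eq_inner
    by (simp add: inner_add_left inner_add_right inner_diff_left inner_diff_right
        inner_commute algebra_simps)
  also have "\<dots> \<ge> 0"
    using t by simp
  finally show "(norm ((1 - t) *\<^sub>R p + t *\<^sub>R r))\<^sup>2 \<le> (1 - t) * (norm p)\<^sup>2 + t * (norm r)\<^sup>2"
    by simp
qed simp


section \<open>The program\<close>

lemma convex_semidefinite_hjb_program: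
  fixes g :: "real^'n \<Rightarrow> real^'m^'n" and c :: "'M::finite \<Rightarrow> real^'n" and y :: "'N::finite \<Rightarrow> real^'n"
  assumes "symmetric_matrix D"
  shows "convex_semidefinite_program (hjb_program \<kappa> c y f g q D P)" (is "convex_semidefinite_program ?prg")
proof -
  have lin: "linear (eq_lhs ?prg)"
    by (intro linearI) (simp_all add: hjb_program_def algebra_simps sum.distrib scaleR_sum_right sum_distrib_left)
  have lmi: "affine_symmetric_matrix_map (lmi ?prg j)" for j
  proof -
    let ?a = "\<lambda>p. 2 * (p \<bullet> kernel_drift \<kappa> c f (y j))" and ?b = "\<lambda>p. p v* kernel_input \<kappa> c g (y j)"
    have "linear ?a" "linear ?b"
      by (auto intro!: linearI simp: inner_add_left algebra_simps vector_matrix_mult_def vec_eq_iff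
          sum.distrib sum_distrib_left)
    \<comment> \<open>The border row \<open>p v* K\<close> and column
      \<open>transpose K *v p\<close> are the same vector, so one linear map b serves for both; the
      state cost enters only the constant corner.\<close>
    from affine_block_matrix[OF this assms, of "2 * q (y j)"] show ?thesis
      by (simp add: hjb_program_def hjb_matrix_def[abs_def] algebra_simps)
  qed
  \<comment> \<open>A linear preimage of a point is intersected with affine preimages of the
    positive semidefinite cone.\<close>
  have "feasible_set ?prg = eq_lhs ?prg -` {eq_rhs ?prg} \<inter> (\<Inter>j. {p. psd (lmi ?prg j p)})"
    by (auto simp: feasible_set_def)
  then have feasible: "convex (feasible_set ?prg)"
    using lmi by (simp add: convex_Int convex_INT convex_linear_vimage[OF lin] convex_psd_preimage)
  \<comment> \<open>The epigraph witness G has corner t, border p and identity block, all affine in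
    the pair (p, t).\<close>
  have "linear (snd :: (real^'M) \<times> real \<Rightarrow> real)" "linear (fst :: (real^'M) \<times> real \<Rightarrow> real^'M)"
    by (rule linear_snd linear_fst)+
  from affine_block_matrix[OF this, of "mat 1" 0]
  have "affine_symmetric_matrix_map (\<lambda>v :: (real^'M) \<times> real. block_matrix (snd v) (fst v) (fst v) (mat 1))"
    by (simp add: symmetric_matrix_mat)
  moreover have "objective ?prg p \<le> t \<longleftrightarrow> psd (block_matrix (snd (p, t)) (fst (p, t)) (fst (p, t)) (mat 1))" for p t
    by (simp add: hjb_program_def psd_block_matrix_identity)
  moreover have "convex_on UNIV (objective ?prg)"
    by (simp add: hjb_program_def convex_on_norm_squared)
  ultimately show ?thesis
    unfolding convex_semidefinite_program_def using lin lmi feasible by blast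
qed

text \<open>The Gram quadratic form at p equals the sum of \<open>p $ i\<close> times the value
  function at the center \<open>c i\<close>. If the value function vanishes at the centers, so does
  the form, and strictness forces p = 0.\<close>

lemma strictly_positive_definite_value_function_eq_0:
  assumes spd: "strictly_positive_definite_kernel \<Omega> \<kappa>" and "inj c" and c: "\<And>i. c i \<in> \<Omega>"
    and zero: "\<And>x. x \<in> \<Omega> \<Longrightarrow> value_function \<kappa> c p x = 0"
  shows "p = 0"
proof (rule ccontr)
  assume "p \<noteq> 0"
  \<comment> \<open>Strict positivity is phrased with weights on points, while p is indexed by
    centers; injectivity of c makes the transfer consistent.\<close>
  define a where "a = (\<lambda>x. p $ inv c x)"
  have a: "a (c i) = p $ i" for i
    using \<open>inj c\<close> by (simp add: a_def)
  have "\<exists>x\<in>range c. a x \<noteq> 0"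
    using \<open>p \<noteq> 0\<close> by (auto simp: vec_eq_iff a)
  moreover have "finite (range c) \<and> range c \<subseteq> \<Omega>"
    using c by auto
  ultimately have "0 < (\<Sum>x\<in>range c. \<Sum>z\<in>range c. a x * a z * \<kappa> x z)"
    using spd[unfolded strictly_positive_definite_kernel_def, rule_format, of "range c" a] by blast
  also have "\<dots> = (\<Sum>i\<in>UNIV. p $ i * value_function \<kappa> c p (c i))"
    using \<open>inj c\<close>
    by (simp add: sum.reindex a value_function_def sum_distrib_left mult.assoc)
  also have "\<dots> = 0"
    using c zero by simp
  finally show False
    by simp
qed

lemma C2_on_kernel_section:
  assumes "C2_on (\<Omega> \<times> \<Omega>) (\<lambda>(x, x'). \<kappa> x x')" and "z \<in> \<Omega>"
  shows "C2_on \<Omega> (\<lambda>x. \<kappa> x z)"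
proof -
  \<comment> \<open>The slice is parametrized as x -> (0, z) + (x, 0).\<close>
  have "bounded_linear (\<lambda>x. (x, 0))"
    by (intro bounded_linear_intros)
  from C2_on_affine_arg[OF this assms(1), of \<Omega> "(0, z)"] assms(2) show ?thesis
    by simp
qed

theorem theorem3p13:
  fixes f :: "real^'n \<Rightarrow> real^'n"
    and g :: "real^'n \<Rightarrow> real^'m^'n"
    and q :: "real^'n \<Rightarrow> real"
    and D :: "real^'m^'m"
    and A Q P :: "real^'n^'n"
    and B :: "real^'m^'n"
    and \<Omega> :: "(real^'n) set"
    and \<kappa> :: "real^'n \<Rightarrow> real^'n \<Rightarrow> real"
    and y :: "'N::finite \<Rightarrow> real^'n"
    and c :: "'M::finite \<Rightarrow> real^'n"
  assumes "C2_on UNIV f" and "C2_on UNIV g" and "C2_on UNIV q"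
    and "f 0 = 0" and "q 0 = 0" and "\<And>x. x \<noteq> 0 \<Longrightarrow> 0 < q x"
    and "posdef D"
    and "A = jacobian f (at 0)" and "B = g 0" and "Q = hessian q 0"
    and "stabilizable A B" and "detectable A (psd_sqrt Q)"
    and "riccati_solution A B D Q P" and "posdef P"
    and "open \<Omega>" and "connected \<Omega>" and "0 \<in> \<Omega>"
    and "symmetric_kernel \<Omega> \<kappa>" and "positive_definite_kernel \<Omega> \<kappa>"
    and "C2_on (\<Omega> \<times> \<Omega>) (\<lambda>(x, x'). \<kappa> x x')"
    and "\<And>j. y j \<in> \<Omega>" and "\<And>i. c i \<in> \<Omega>"
  shows "convex_semidefinite_program (hjb_program \<kappa> c y f g q D P) \<and>
    0 \<notin> feasible_set (hjb_program \<kappa> c y f g q D P) \<and>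
    (\<forall>p \<in> feasible_set (hjb_program \<kappa> c y f g q D P).
      \<not> (\<forall>x\<in>\<Omega>. value_function \<kappa> c p x = 0)) \<and>
    (strictly_positive_definite_kernel \<Omega> \<kappa> \<and> inj c \<longrightarrow>
      (\<forall>p. p = 0 \<longleftrightarrow> (\<forall>x\<in>\<Omega>. value_function \<kappa> c p x = 0))) \<and>
    (\<forall>p \<in> feasible_set (hjb_program \<kappa> c y f g q D P).
      C2_on \<Omega> (value_function \<kappa> c p) \<and>
      value_function \<kappa> c p 0 = 0 \<and>
      gradient (value_function \<kappa> c p) 0 = 0 \<and>
      hessian (value_function \<kappa> c p) 0 = P)"
proof -
  let ?prg = "hjb_program \<kappa> c y f g q D P"
  let ?V = "value_function \<kappa> c"
  have k: "C2_on \<Omega> (\<lambda>x. \<kappa> x (c i))" for i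
    by (rule C2_on_kernel_section[OF \<open>C2_on (\<Omega> \<times> \<Omega>) (\<lambda>(x, x'). \<kappa> x x')\<close> \<open>c i \<in> \<Omega>\<close>])
  have V: "?V p = (\<lambda>x. \<Sum>i\<in>UNIV. p $ i * \<kappa> x (c i))" for p
    by (simp add: value_function_def fun_eq_iff)
  have convex: "convex_semidefinite_program ?prg"
    using \<open>posdef D\<close> by (intro convex_semidefinite_hjb_program) (simp add: posdef_def)
  have nonzero: "0 \<notin> feasible_set ?prg"
    \<comment> \<open>At p = 0 the Hessian constraint would read 0 = P.\<close>
    using posdef_nonzero[OF \<open>posdef P\<close>] by (auto simp: feasible_set_def hjb_program_def)
  have C2: "C2_on \<Omega> (?V p)" for p
    using C2_on_linear_combination[of UNIV \<Omega> "\<lambda>i x. \<kappa> x (c i)" "\<lambda>i. p $ i", OF k] by (simp add: V)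
  \<comment> \<open>Linearity identifies the value, gradient and Hessian of V at 0 with the three
    components of \<open>eq_lhs\<close>.\<close>
  have jet: "?V p 0 = 0" "gradient (?V p) 0 = 0" "hessian (?V p) 0 = P"
    if "p \<in> feasible_set ?prg" for p
    using that
      gradient_linear_combination[of UNIV \<Omega> "\<lambda>i x. \<kappa> x (c i)" 0 "\<lambda>i. p $ i", OF k \<open>0 \<in> \<Omega>\<close>]
      hessian_linear_combination[of UNIV \<Omega> "\<lambda>i x. \<kappa> x (c i)" 0 "\<lambda>i. p $ i", OF k \<open>open \<Omega>\<close> \<open>0 \<in> \<Omega>\<close>]
    by (simp_all add: V feasible_set_def hjb_program_def)
  have nontrivial: "\<not> (\<forall>x\<in>\<Omega>. ?V p x = 0)" if "p \<in> feasible_set ?prg" for p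
    using jet(3)[OF that] hessian_eq_0[OF \<open>open \<Omega>\<close> \<open>0 \<in> \<Omega>\<close>, of "?V p"] posdef_nonzero[OF \<open>posdef P\<close>]
    by auto
  have "p = 0 \<longleftrightarrow> (\<forall>x\<in>\<Omega>. ?V p x = 0)"
    if "strictly_positive_definite_kernel \<Omega> \<kappa>" "inj c" for p
  proof
    show "\<forall>x\<in>\<Omega>. ?V p x = 0" if "p = 0"
      using that by (simp add: V)
    show "p = 0" if "\<forall>x\<in>\<Omega>. ?V p x = 0"
      using strictly_positive_definite_value_function_eq_0[OF
          \<open>strictly_positive_definite_kernel \<Omega> \<kappa>\<close> \<open>inj c\<close> \<open>\<And>i. c i \<in> \<Omega>\<close>] that
      by blast
  qed
  with convex nonzero C2 jet nontrivial show ?thesis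
    by blast
qed

end
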